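(* Let $0\le a<b<\infty$, $\Delta=[a,b]$, let $\Phi\in C^1(\Delta,\mathbb R)$ be increasing with $\Phi'(\ell)\neq 0$ for all $\ell\in\Delta$. Let $\kappa,\mu\in(0,1]$ with $\kappa<\mu$ and let $\omega>0$. If $\gamma\in C(\Delta,\mathbb R)$ satisfies ${}^c\mathbb D_{a^+}^{\mu;\Phi}\gamma,\ {}^c\mathbb D_{a^+}^{\kappa;\Phi}\gamma\in C(\Delta,\mathbb R)$ and $$ {}^c\mathbb D_{a^+}^{\mu;\Phi}\gamma(\ell)+\omega\,{}^c\mathbb D_{a^+}^{\kappa;\Phi}\gamma(\ell)\ge 0\ \text{ for }\ell\in(a,b],\qquad \gamma(a)\ge 0, $$ then $\gamma(\ell)\ge 0$ for all $\ell\in\Delta$.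
   Context: For $\alpha>0$ and integrable $\mathfrak z:\Delta\to\mathbb R$, the $\Phi$-Riemann–Liouville integral is $\mathbb I_{a^+}^{\alpha;\Phi}\mathfrak z(\ell)=\frac1{\Gamma(\alpha)}\int_a^\ell\Phi'(\rho)(\Phi(\ell)-\Phi(\rho))^{\alpha-1}\mathfrak z(\rho)\,\mathrm d\rho$; $\mathbb I_{a^+}^{0;\Phi}$ is the identity. For $0<\alpha\le1$ and $\mathfrak z\in C^1(\Delta,\mathbb R)$, the $\Phi$-Caputo derivative is ${}^c\mathbb D_{a^+}^{\alpha;\Phi}\mathfrak z=\mathbb I_{a^+}^{1-\alpha;\Phi}\bigl(\mathfrak z'/\Phi'\bigr)$ (so for $\alpha=1$ it is $\mathfrak z'/\Phi'$). For $\mathfrak z$ that is only continuous, it is understood in the standard extended sense ${}^c\mathbb D_{a^+}^{\alpha;\Phi}\mathfrak z(\ell)=\frac{1}{\Phi'(\ell)}\frac{\mathrm d}{\mathrm d\ell}\,\mathbb I_{a^+}^{1-\alpha;\Phi}\bigl(\mathfrak z-\mathfrak z(a)\bigr)(\ell)$, which agrees with the previous formula for $C^1$ functions; "${}^c\mathbb D_{a^+}^{\alpha;\Phi}\mathfrak z\in C(\Delta,\mathbb R)$" means that $\mathbb I_{a^+}^{1-\alpha;\Phi}(\mathfrak z-\mathfrak z(a))$ is continuously differentiable on $\Delta$ (one-sided at the endpoints). *)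

theory Defs
  imports "HOL-Analysis.Analysis"
begin

(* Derivatives on [a, b] are taken within [a, b], hence one-sided at the endpoints; functions are
   total, but their values outside [a, b] play no role.  (The library's C1_differentiable_on
   demands two-sided derivatives and is therefore not suitable on a closed interval.) *)

definition deriv_Icc :: "real \<Rightarrow> real \<Rightarrow> (real \<Rightarrow> real) \<Rightarrow> real \<Rightarrow> real" where
  "deriv_Icc a b f x = vector_derivative f (at x within {a..b})"

definition C1_Icc :: "real \<Rightarrow> real \<Rightarrow> (real \<Rightarrow> real) \<Rightarrow> bool" where
  "C1_Icc a b f \<longleftrightarrow> f differentiable_on {a..b} \<and> continuous_on {a..b} (deriv_Icc a b f)"

(* At the single point r = l the library value 0 powr (\<alpha> - 1) = 0 is used; this does not affect
   the integral. *)

definition RL_integral ::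
  "real \<Rightarrow> real \<Rightarrow> (real \<Rightarrow> real) \<Rightarrow> real \<Rightarrow> (real \<Rightarrow> real) \<Rightarrow> real \<Rightarrow> real" where
  "RL_integral a b \<Phi> \<alpha> z l =
     (if \<alpha> = 0 then z l
      else 1 / Gamma \<alpha> *
        (LINT r:{a..l}|lebesgue. deriv_Icc a b \<Phi> r * (\<Phi> l - \<Phi> r) powr (\<alpha> - 1) * z r))"

(* The Caputo derivative in the extended sense, for functions z that are merely continuous. *)

definition Caputo_deriv ::
  "real \<Rightarrow> real \<Rightarrow> (real \<Rightarrow> real) \<Rightarrow> real \<Rightarrow> (real \<Rightarrow> real) \<Rightarrow> real \<Rightarrow> real" where
  "Caputo_deriv a b \<Phi> \<alpha> z l =
     1 / deriv_Icc a b \<Phi> l *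
       deriv_Icc a b (RL_integral a b \<Phi> (1 - \<alpha>) (\<lambda>r. z r - z a)) l"

(* The Caputo derivative exists and is continuous on [a, b].  Continuity of the total function
   Caputo_deriv alone would not express existence of the derivative. *)

definition has_continuous_Caputo_deriv ::
  "real \<Rightarrow> real \<Rightarrow> (real \<Rightarrow> real) \<Rightarrow> real \<Rightarrow> (real \<Rightarrow> real) \<Rightarrow> bool" where
  "has_continuous_Caputo_deriv a b \<Phi> \<alpha> z \<longleftrightarrow>
     C1_Icc a b (RL_integral a b \<Phi> (1 - \<alpha>) (\<lambda>r. z r - z a))"

end

theory Submission
  imports Defs
begin

text \<open>
  In the variable \<open>x = \<Phi> l - \<Phi> a\<close>, and with \<open>u\<close> denoting \<open>\<gamma> - \<gamma> a\<close> as a function of \<open>x\<close>, extended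
  by zero to \<open>x \<le> 0\<close>, both \<open>\<Phi>\<close>-Riemann-Liouville integrals become ordinary convolutions with power
  kernels (the one of order \<open>1 - \<mu>\<close> is the identity if \<open>\<mu> = 1\<close>). Multiplied by \<open>\<Phi>' > 0\<close>, the differential inequality says that
  \<open>G x = c u(x) + \<integral>\<^sub>0\<^sup>x k(s) u(x - s) ds\<close> is nondecreasing, where \<open>k\<close> is positive, decreasing and
  integrable at 0, and \<open>c = 1\<close> if \<open>\<mu> = 1\<close>, otherwise \<open>c = 0\<close>. It is enough to show that this forces
  \<open>u \<ge> 0\<close> (\<open>nonneg_of_mono_convolution\<close>); since \<open>\<gamma> a \<ge> 0\<close>, then \<open>\<gamma> \<ge> 0\<close>.

  A maximum principle applied to \<open>u\<close> itself would need more than continuity, because \<open>k\<close> is singular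
  at 0. So it is applied to the sliding integral \<open>U x = \<integral> u\<close> over \<open>[x - d, x]\<close>, which is continuously
  differentiable. If \<open>u\<close> is negative somewhere, then for small \<open>d\<close> the minimum of \<open>U\<close> is negative; let
  it be attained at \<open>t > 0\<close>. On the one hand \<open>G t - G (t - d) \<ge> 0\<close>, where \<open>G\<close> is continued by zero to the
  left of 0. On the other hand this difference is
  \<open>c w(0) + \<integral>\<^sub>0\<^sup>t k(s) w(s) ds\<close> with \<open>w s = u (t - s) - u (t - d - s)\<close>, the derivative of \<open>U\<close> at \<open>t - s\<close>.
  The primitive \<open>U t - U (t - s)\<close> of \<open>w\<close> is nowhere positive, by minimality of \<open>U t\<close>, and so the second mean
  value theorem for the decreasing weight \<open>k\<close> bounds the integral by \<open>k(t) U(t) < 0\<close>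
  (\<open>integral_antimono_kernel_le\<close>), while \<open>w 0 = U' t \<le> 0\<close>. This is a contradiction.
\<close>

section \<open>Monotone kernels and sign of a convolution\<close>

lemma absolutely_integrable_mult_continuous:
  fixes k w :: "real \<Rightarrow> real"
  assumes "k absolutely_integrable_on {a..b}" and "continuous_on {a..b} w"
  shows "(\<lambda>s. k s * w s) absolutely_integrable_on {a..b}"
proof -
  have "(\<lambda>s. w s * k s) absolutely_integrable_on {a..b}"
    using assms
    by (intro absolutely_integrable_bounded_measurable_product_real)
       (auto intro: continuous_imp_measurable_on_sets_lebesgue
          compact_imp_bounded compact_continuous_image)
  then show ?thesis by (simp add: mult.commute)
qed

text \<open>
  Formally, with \<open>V\<close> the primitive of \<open>w\<close>, integration by parts gives
  \<open>k(T) V(T) + \<integral> (-k') V\<close>, whose second term is not positive. The second mean value theorem replaces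
  the integration by parts, so that no derivative of \<open>k\<close> is involved. It is applied on \<open>[e, T]\<close>, away
  from the possible singularity of \<open>k\<close>; the boundary term \<open>k(e) V(e) = O(e k(e))\<close> vanishes as
  \<open>e \<rightarrow> 0\<close> because \<open>e k(e) \<le> \<integral>\<^sub>0\<^sup>e k\<close> for a decreasing integrable kernel.
\<close>

lemma integral_antimono_kernel_le:
  fixes k w :: "real \<Rightarrow> real"
  assumes T: "0 < T"
    and k_nonneg: "\<And>s. s \<in> {0..T} \<Longrightarrow> 0 \<le> k s"
    and k_antimono: "antimono_on {0<..T} k"
    and k_int: "k absolutely_integrable_on {0..T}"
    and w: "continuous_on {0..T} w"
    and primitive_nonpos: "\<And>s. s \<in> {0..T} \<Longrightarrow> integral {0..s} w \<le> 0"
  shows "integral {0..T} (\<lambda>s. k s * w s) \<le> k T * integral {0..T} w"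
proof -
  define V where "V s = integral {0..s} w" for s
  have kw: "(\<lambda>s. k s * w s) integrable_on {0..T}"
    using absolutely_integrable_mult_continuous[OF k_int w] set_lebesgue_integral_eq_integral(1) by blast
  have k_hk: "k integrable_on {0..T}"
    using k_int set_lebesgue_integral_eq_integral(1) by blast
  have w_int: "w integrable_on {0..T}"
    using w by (rule integrable_continuous_real)
  obtain B where B: "\<And>s. s \<in> {0..T} \<Longrightarrow> \<bar>w s\<bar> \<le> B"
    using compact_imp_bounded[OF compact_continuous_image[OF w]]
    unfolding bounded_iff by (metis compact_Icc image_eqI real_norm_def)
  have B0: "0 \<le> B" using B[of 0] T by auto
  have key: "integral {e..T} (\<lambda>s. k s * w s) \<le> k T * V T + B * integral {0..e} k"
    if e: "0 < e" "e < T" for e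
  proof -
    have "w integrable_on {e..T}"
      using w_int e by (rule_tac integrable_on_subinterval) auto
    then obtain c where c: "c \<in> {e..T}"
      and eq: "integral {e..T} (\<lambda>s. - k s * w s) = - k e * integral {e..c} w + - k T * integral {c..T} w"
      by (rule second_mean_value_theorem[where g = "\<lambda>s. - k s"])
         (use e k_antimono in \<open>auto simp: monotone_on_def\<close>)
    have split: "integral {x..y} w = V y - V x" if "0 \<le> x" "x \<le> y" "y \<le> T" for x y
      using Henstock_Kurzweil_Integration.integral_combine[of 0 x y w] that
        integrable_on_subinterval[OF w_int, of 0 y] by (auto simp: V_def)
    have "integral {e..T} (\<lambda>s. k s * w s) = k e * (V c - V e) + k T * (V T - V c)"
      using eq split[of e c] split[of c T] c e by simp
    also have "\<dots> = k T * V T + (k e - k T) * V c + k e * (- V e)"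
      by (simp add: algebra_simps)
    also have "\<dots> \<le> k T * V T + 0 + k e * (B * e)"
    proof -
      have "k T \<le> k e" using k_antimono e by (auto simp: monotone_on_def)
      moreover have "V c \<le> 0" using primitive_nonpos[of c] c e by (auto simp: V_def)
      ultimately have "(k e - k T) * V c \<le> 0"
        by (simp add: mult_nonneg_nonpos)
      moreover have "norm (integral {0..e} w) \<le> B * (e - 0)"
        using w e B by (intro integral_bound) (auto intro: continuous_on_subset)
      then have "- V e \<le> B * e" by (simp add: V_def)
      then have "k e * (- V e) \<le> k e * (B * e)"
        using k_nonneg[of e] e by (intro mult_left_mono) auto
      ultimately show ?thesis by linarith
    qed
    also have "k e * (B * e) = B * (e * k e)" by simp
    also have "e * k e \<le> integral {0..e} k"
    proof -
      \<comment> \<open>\<open>k\<close> is only known to decrease on \<open>(0, T]\<close>, so the constant \<open>k e\<close> may exceed \<open>k\<close> at 0.\<close>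
      have "integral {0..e} (\<lambda>s. if s = 0 then 0 else k e) \<le> integral {0..e} k"
      proof (rule integral_le)
        show "(\<lambda>s. if s = 0 then 0 else k e) integrable_on {0..e}"
          by (rule integrable_spike[where S = "{0}" and f = "\<lambda>_. k e"]) auto
        show "k integrable_on {0..e}"
          using k_hk e by (rule_tac integrable_on_subinterval) auto
      qed (use e k_antimono k_nonneg in \<open>auto simp: monotone_on_def\<close>)
      also have "integral {0..e} (\<lambda>s. if s = 0 then 0 else k e) = integral {0..e} (\<lambda>_. k e)"
        by (rule integral_spike[where S = "{0}"]) auto
      finally show ?thesis using e by simp
    qed
    finally show ?thesis using B0 by (simp add: mult_left_mono)
  qed
  have "((\<lambda>e. integral {e..T} (\<lambda>s. k s * w s)) \<longlongrightarrow> integral {0..T} (\<lambda>s. k s * w s)) (at_right 0)"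
    using indefinite_integral_continuous_1'[OF kw] T at_within_Icc_at_right[of 0 T]
    by (force simp: continuous_on_def)
  moreover have "((\<lambda>e. integral {0..e} k) \<longlongrightarrow> integral {0..0} k) (at_right 0)"
    using indefinite_integral_continuous_1[OF k_hk] T at_within_Icc_at_right[of 0 T]
    by (force simp: continuous_on_def)
  then have "((\<lambda>e. k T * V T + B * integral {0..e} k) \<longlongrightarrow> k T * V T + B * 0) (at_right 0)"
    by (intro tendsto_intros) auto
  moreover have "\<forall>\<^sub>F e in at_right 0. integral {e..T} (\<lambda>s. k s * w s) \<le> k T * V T + B * integral {0..e} k"
    using eventually_at_right_less[of 0] eventually_at_rightI[of 0 T "\<lambda>e. e < T"] T
    by (auto elim!: eventually_elim2 intro: key)
  ultimately show ?thesis
    by (auto simp: V_def intro: tendsto_le[OF trivial_limit_at_right_real])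
qed

text \<open>
  A positivity principle for Volterra operators. The term \<open>c * u x\<close> allows the kernel an atom at 0,
  which is what the Riemann-Liouville kernel degenerates to at order 0.
\<close>

theorem nonneg_of_mono_convolution:
  fixes k u :: "real \<Rightarrow> real"
  assumes k_nonneg: "\<And>s. 0 \<le> k s"
    and k_pos: "\<And>s. 0 < s \<Longrightarrow> 0 < k s"
    and k_antimono: "antimono_on {0<..} k"
    and k_int: "\<And>x. 0 \<le> x \<Longrightarrow> k absolutely_integrable_on {0..x}"
    and c: "0 \<le> c"
    and u: "continuous_on UNIV u"
    and u0: "\<And>x. x \<le> 0 \<Longrightarrow> u x = 0"
    and mono: "mono_on {0..T} (\<lambda>x. c * u x + integral {0..x} (\<lambda>s. k s * u (x - s)))"
    and x: "x \<in> {0..T}"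
  shows "0 \<le> u x"
proof (rule ccontr)
  assume neg: "\<not> 0 \<le> u x"
  have x0: "0 < x" using neg u0[of x] by force
  have u_at: "isCont u y" for y using u by (simp add: continuous_on_eq_continuous_at)
  have "\<exists>d>0. \<forall>y. dist y x < d \<longrightarrow> u y < 0"
  proof -
    have "\<forall>\<^sub>F y in nhds x. u y < 0"
      using u_at[of x] neg
      by (intro order_tendstoD(2)[where y = "u x"]) (auto simp: isCont_def tendsto_at_iff_tendsto_nhds)
    then show ?thesis by (simp add: eventually_nhds_metric)
  qed
  then obtain d0 where d0: "d0 > 0" "\<And>y. \<bar>y - x\<bar> < d0 \<Longrightarrow> u y < 0"
    by (auto simp: dist_real_def)
  define d where "d = d0 / 2"
  have d: "d > 0" "d < d0" using d0 by (auto simp: d_def)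
  \<comment> \<open>The lower limit lies left of every argument used below, so that \<open>P\<close> has two-sided derivatives there.\<close>
  define P where "P y = integral {-d-1..y} u" for y
  have P: "(P has_real_derivative u y) (at y)" if "-d-1 < y" for y
  proof -
    have "(P has_real_derivative u y) (at y within {-d-1..y+1})"
      unfolding P_def using that u
      by (intro integral_has_real_derivative) (auto intro: continuous_on_subset)
    then show ?thesis using that by (simp add: at_within_Icc_at)
  qed
  define U where "U y = P y - P (y - d)" for y
  have U: "(U has_real_derivative u y - u (y - d)) (at y)" if "-1 < y" for y
    unfolding U_def using that d(1) P[of y] P[of "y - d"] DERIV_shift[of P "u (y - d)" y "- d"]
    by (intro DERIV_diff) auto
  have U_mvt: "\<exists>z. y - d < z \<and> z < y \<and> U y = d * u z" if "-1 < y" for y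
    using MVT2[of "y - d" y P u] P d(1) that by (force simp: U_def)
  have U_x: "U x < 0"
  proof -
    obtain z where "x - d < z" "z < x" "U x = d * u z" using U_mvt[of x] x0 by auto
    then show ?thesis using d d0(2)[of z] by (auto simp: mult_pos_neg)
  qed
  have "continuous_on {0..T} U"
    by (intro continuous_at_imp_continuous_on ballI DERIV_isCont[OF U]) simp
  then obtain t where t: "t \<in> {0..T}" and t_min: "\<And>y. y \<in> {0..T} \<Longrightarrow> U t \<le> U y"
    using continuous_attains_inf[of "{0..T}" U] x by (metis compact_Icc empty_iff)
  have U_t: "U t < 0" using t_min[OF x] U_x by simp
  have "U 0 = 0" using U_mvt[of 0] u0 by auto
  then have t0: "0 < t" using U_t t by (cases "t = 0") auto
  define w where "w s = u (t - s) - u (t - d - s)" for s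
  have w_prim: "integral {0..s} w = U t - U (t - s)" if "0 \<le> s" "s \<le> t" for s
  proof -
    have "(w has_integral (- U (t - s) - - U (t - 0))) {0..s}"
    proof (rule fundamental_theorem_of_calculus)
      fix y assume "y \<in> {0..s}"
      then have "((\<lambda>y. - U (t - y)) has_real_derivative w y) (at y)"
        using that by (auto intro!: derivative_eq_intros DERIV_chain'[OF _ U] simp: w_def algebra_simps)
      then show "((\<lambda>y. - U (t - y)) has_vector_derivative w y) (at y within {0..s})"
        by (simp add: has_real_derivative_iff_has_vector_derivative has_vector_derivative_at_within)
    qed (use that in auto)
    then show ?thesis by (simp add: integral_unique)
  qed
  have cont: "continuous_on A (\<lambda>s. u (y - s))" for A y
    by (intro continuous_on_compose2[OF u] continuous_intros) auto
  have w_cont: "continuous_on {0..t} w"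
    unfolding w_def by (intro continuous_intros cont)
  have prod_int: "(\<lambda>s. k s * u (y - s)) integrable_on {0..t}" for y
    by (rule set_lebesgue_integral_eq_integral(1)[OF absolutely_integrable_mult_continuous[OF k_int cont]])
       (use t0 in simp)
  have "integral {0..t} (\<lambda>s. k s * w s) \<le> k t * integral {0..t} w"
  proof (rule integral_antimono_kernel_le[OF t0 k_nonneg _ k_int w_cont])
    show "antimono_on {0<..t} k" using k_antimono by (simp add: monotone_on_def)
    show "integral {0..s} w \<le> 0" if "s \<in> {0..t}" for s
      using w_prim[of s] t_min[of "t - s"] that t by simp
  qed (use t0 in simp)
  also have "\<dots> < 0"
    using w_prim[of t] t0 \<open>U 0 = 0\<close> U_t k_pos[of t] by (simp add: mult_pos_neg)
  finally have conv_neg: "integral {0..t} (\<lambda>s. k s * w s) < 0" .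
  have w0: "w 0 \<le> 0"
  proof (rule ccontr)
    assume "\<not> w 0 \<le> 0"
    then obtain r where r: "r > 0" "\<And>h. h > 0 \<Longrightarrow> h < r \<Longrightarrow> U (t - h) < U t"
      using DERIV_pos_inc_left[OF U[of t]] t0 by (auto simp: w_def)
    define h where "h = min (r / 2) t"
    have "0 < h" "h < r" "h \<le> t" using r(1) t0 by (auto simp: h_def)
    then show False using r(2)[of h] t_min[of "t - h"] t by simp
  qed
  define G where "G y = c * u y + integral {0..y} (\<lambda>s. k s * u (y - s))" for y
  \<comment> \<open>\<open>H\<close> is \<open>G (t - d)\<close>, with \<open>G\<close> continued by zero to negative arguments; written as an integral over
      \<open>[0, t]\<close>, where \<open>u\<close> vanishes for \<open>s > t - d\<close>, it can be subtracted from \<open>G t\<close>.\<close>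
  define H where "H = c * u (t - d) + integral {0..t} (\<lambda>s. k s * u (t - d - s))"
  have "H \<le> G t"
  proof -
    have H: "H = G (max 0 (t - d))"
    proof (cases "d \<le> t")
      case True
      have "integral {0..t-d} (\<lambda>s. k s * u (t - d - s)) = integral {0..t} (\<lambda>s. k s * u (t - d - s))"
        using True d u0 by (intro integral_spike_set empty_imp_negligible) auto
      then show ?thesis using True by (simp add: H_def G_def)
    next
      case False
      then have "integral {0..t} (\<lambda>s. k s * u (t - d - s)) = integral {0..t} (\<lambda>s. 0)"
        using u0 by (intro integral_cong) auto
      then show ?thesis using False u0 by (simp add: H_def G_def max_def)
    qed
    show ?thesis unfolding H using mono t d t0 by (auto simp: G_def monotone_on_def)
  qed
  moreover have "G t - H = c * w 0 + integral {0..t} (\<lambda>s. k s * w s)"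
    using integral_diff[OF prod_int[of t] prod_int[of "t - d"]]
    by (simp add: G_def H_def w_def algebra_simps)
  ultimately show False
    using conv_neg w0 c mult_nonneg_nonpos[of c "w 0"] by linarith
qed

section \<open>Continuously differentiable functions on a compact interval\<close>

lemma C1_Icc_has_real_derivative:
  assumes "C1_Icc a b f" and "x \<in> {a..b}"
  shows "(f has_real_derivative deriv_Icc a b f x) (at x within {a..b})"
  using assms
  by (auto simp: C1_Icc_def differentiable_on_def deriv_Icc_def
      has_real_derivative_iff_has_vector_derivative vector_derivative_works)

lemma C1_Icc_continuous_on: "C1_Icc a b f \<Longrightarrow> continuous_on {a..b} f"
  by (simp add: C1_Icc_def differentiable_imp_continuous_on)

text \<open>
  Monotonicity gives the sign of the derivative at interior points; continuity carries it to the endpoints.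
\<close>

lemma mono_deriv_Icc_pos:
  assumes "a < b" and C1: "C1_Icc a b \<Phi>" and mono: "mono_on {a..b} \<Phi>"
    and nz: "\<forall>l\<in>{a..b}. deriv_Icc a b \<Phi> l \<noteq> 0" and x: "x \<in> {a..b}"
  shows "0 < deriv_Icc a b \<Phi> x"
proof -
  have "0 \<le> deriv_Icc a b \<Phi> x"
  proof (rule continuous_ge_on_closure[where S = "{a<..<b}" and f = "deriv_Icc a b \<Phi>" and x = x])
    show "continuous_on (closure {a<..<b}) (deriv_Icc a b \<Phi>)"
      using C1 \<open>a < b\<close> by (simp add: C1_Icc_def)
    show "x \<in> closure {a<..<b}" using x \<open>a < b\<close> by simp
    show "0 \<le> deriv_Icc a b \<Phi> y" if y: "y \<in> {a<..<b}" for y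
    proof (rule mono_on_imp_deriv_nonneg[OF mono])
      show "(\<Phi> has_real_derivative deriv_Icc a b \<Phi> y) (at y)"
        using C1_Icc_has_real_derivative[OF C1, of y] y by (simp add: at_within_Icc_at)
    qed (use y in simp)
  qed
  then show ?thesis using nz x by force
qed

lemma nonneg_deriv_Icc_imp_mono_on:
  assumes f: "C1_Icc a b f" and nonneg: "\<And>x. x \<in> {a<..<b} \<Longrightarrow> 0 \<le> deriv_Icc a b f x"
  shows "mono_on {a..b} f"
proof (rule mono_onI)
  fix x y assume xy: "x \<in> {a..b}" "y \<in> {a..b}" "x \<le> y"
  show "f x \<le> f y"
  proof (rule DERIV_nonneg_imp_increasing_open[OF \<open>x \<le> y\<close>])
    show "\<exists>D. DERIV f w :> D \<and> 0 \<le> D" if "x < w" "w < y" for w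
      using C1_Icc_has_real_derivative[OF f, of w] nonneg[of w] that xy
      by (auto simp: at_within_Icc_at)
    show "continuous_on {x..y} f"
      using C1_Icc_continuous_on[OF f] xy by (auto intro: continuous_on_subset)
  qed
qed

lemma C1_Icc_add_mult:
  assumes f: "C1_Icc a b f" and g: "C1_Icc a b g" and "a < b"
  shows "C1_Icc a b (\<lambda>x. f x + c * g x)"
    and "\<And>x. x \<in> {a..b} \<Longrightarrow>
      deriv_Icc a b (\<lambda>x. f x + c * g x) x = deriv_Icc a b f x + c * deriv_Icc a b g x"
proof -
  have D: "((\<lambda>x. f x + c * g x) has_real_derivative
      deriv_Icc a b f x + c * deriv_Icc a b g x) (at x within {a..b})" if "x \<in> {a..b}" for x
    using C1_Icc_has_real_derivative[OF f that] C1_Icc_has_real_derivative[OF g that]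
    by (auto intro!: derivative_eq_intros)
  show eq: "deriv_Icc a b (\<lambda>x. f x + c * g x) x = deriv_Icc a b f x + c * deriv_Icc a b g x"
    if "x \<in> {a..b}" for x
    unfolding deriv_Icc_def[of a b "\<lambda>x. f x + c * g x"]
    using D[OF that] that \<open>a < b\<close>
    by (intro vector_derivative_within_closed_interval)
       (auto simp: has_real_derivative_iff_has_vector_derivative)
  have "(\<lambda>x. f x + c * g x) differentiable_on {a..b}"
    using D unfolding differentiable_on_def real_differentiable_def by blast
  moreover have "continuous_on {a..b} (deriv_Icc a b (\<lambda>x. f x + c * g x))"
    using f g by (subst continuous_on_cong[OF refl eq]) (auto simp: C1_Icc_def intro!: continuous_intros)
  ultimately show "C1_Icc a b (\<lambda>x. f x + c * g x)" by (simp add: C1_Icc_def)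
qed

section \<open>Riemann-Liouville integrals as convolutions\<close>

text \<open>
  At order 0 the kernel should be a point mass. The formula gives the zero function there, since
  \<open>Gamma 0 = 0\<close> and division by zero yields zero; the point mass is carried by a separate term below.
\<close>

definition RL_kernel :: "real \<Rightarrow> real \<Rightarrow> real" where
  "RL_kernel \<beta> s = s powr (\<beta> - 1) / Gamma \<beta>"

lemma RL_kernel_0 [simp]: "RL_kernel 0 s = 0"
  by (simp add: RL_kernel_def Gamma_eq_zero_iff)

lemma RL_kernel_nonneg: "0 \<le> \<beta> \<Longrightarrow> 0 \<le> RL_kernel \<beta> s"
  by (cases "\<beta> = 0") (auto simp: RL_kernel_def)

lemma RL_kernel_pos: "0 < \<beta> \<Longrightarrow> 0 < s \<Longrightarrow> 0 < RL_kernel \<beta> s"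
  by (simp add: RL_kernel_def)

lemma RL_kernel_antimono:
  assumes "0 \<le> \<beta>" and "\<beta> \<le> 1"
  shows "antimono_on {0<..} (RL_kernel \<beta>)"
proof (cases "\<beta> = 0")
  case False
  then have "0 < Gamma \<beta>" using assms by simp
  then show ?thesis
    using assms by (auto simp: monotone_on_def RL_kernel_def intro!: divide_right_mono powr_mono2')
qed (simp add: monotone_on_def)

lemma RL_kernel_absolutely_integrable:
  assumes "0 \<le> \<beta>" and "0 \<le> x"
  shows "RL_kernel \<beta> absolutely_integrable_on {0..x}"
proof (cases "\<beta> = 0")
  case True
  then have "RL_kernel \<beta> = (\<lambda>_. 0)" by (simp add: fun_eq_iff)
  then show ?thesis by simp
next
  case False
  then have "(\<lambda>s. s powr (\<beta> - 1)) integrable_on {0..x}"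
    using assms by (intro integrable_on_powr_from_0) auto
  then have "RL_kernel \<beta> integrable_on {0..x}"
    unfolding RL_kernel_def by (rule integrable_on_divide)
  then show ?thesis
    using assms RL_kernel_nonneg by (intro nonnegative_absolutely_integrable_1) auto
qed

text \<open>
  The substitution \<open>s = \<Phi> l - \<Phi> r\<close>, under which \<open>ds = - \<Phi>'(r) dr\<close> and \<open>\<Phi> r - \<Phi> a = \<Phi> l - \<Phi> a - s\<close>.
  For \<open>\<beta> < 1\<close> the integrand may be unbounded at \<open>s = 0\<close>, hence the change of variables for absolutely integrable functions.
\<close>

lemma RL_integral_eq_convolution:
  assumes "0 \<le> \<beta>" and C1: "C1_Icc a b \<Phi>" and smono: "strict_mono_on {a..b} \<Phi>"
    and pos: "\<And>x. x \<in> {a..b} \<Longrightarrow> 0 < deriv_Icc a b \<Phi> x"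
    and u: "continuous_on UNIV u"
    and z: "\<And>r. r \<in> {a..b} \<Longrightarrow> z r = u (\<Phi> r - \<Phi> a)"
    and l: "l \<in> {a..b}"
  shows "RL_integral a b \<Phi> \<beta> z l =
    (if \<beta> = 0 then 1 else 0) * u (\<Phi> l - \<Phi> a) +
    integral {0..\<Phi> l - \<Phi> a} (\<lambda>s. RL_kernel \<beta> s * u (\<Phi> l - \<Phi> a - s))"
proof (cases "\<beta> = 0")
  case True
  then show ?thesis using z l by (simp add: RL_integral_def)
next
  case False
  define X where "X = \<Phi> l - \<Phi> a"
  define f where "f s = RL_kernel \<beta> s * u (X - s)" for s
  let ?g = "\<lambda>r. \<Phi> l - \<Phi> r"
  have le: "\<Phi> x \<le> \<Phi> y" if "a \<le> x" "x \<le> y" "y \<le> b" for x y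
    using strict_mono_on_leD[OF smono, of x y] that by auto
  have cont: "continuous_on {a..l} ?g"
    using C1_Icc_continuous_on[OF C1] l by (intro continuous_intros) (auto intro: continuous_on_subset)
  have img: "?g ` {a..l} = {0..X}"
  proof (rule antisym)
    show "?g ` {a..l} \<subseteq> {0..X}" using le l by (auto simp: X_def)
    show "{0..X} \<subseteq> ?g ` {a..l}"
      using IVT2'[of ?g l _ a] cont l by (fastforce simp: X_def)
  qed
  have "X \<ge> 0" using le[of a l] l by (simp add: X_def)
  then have f_int: "f absolutely_integrable_on {0..X}"
    unfolding f_def using assms(1)
    by (intro absolutely_integrable_mult_continuous RL_kernel_absolutely_integrable
        continuous_on_compose2[OF u] continuous_intros) auto
  have der: "(?g has_real_derivative - deriv_Icc a b \<Phi> r) (at r within {a..l})" if "r \<in> {a..l}" for r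
    using has_field_derivative_subset[OF C1_Icc_has_real_derivative[OF C1, of r], of "{a..l}"] that l
    by (auto intro!: derivative_eq_intros)
  have inj: "inj_on ?g {a..l}"
    using strict_mono_on_imp_inj_on[OF smono] l by (auto simp: inj_on_def)
  let ?h = "\<lambda>r. \<bar>- deriv_Icc a b \<Phi> r\<bar> * f (?g r)"
  have h: "?h absolutely_integrable_on {a..l}" "integral {a..l} ?h = integral {0..X} f"
    using has_absolute_integral_change_of_variables_1'[OF _ der inj, of f "integral {0..X} f"] f_int img
    by auto
  have "RL_integral a b \<Phi> \<beta> z l =
      (LINT r:{a..l}|lebesgue. 1 / Gamma \<beta> * (deriv_Icc a b \<Phi> r * (\<Phi> l - \<Phi> r) powr (\<beta> - 1) * z r))"
    using False by (simp add: RL_integral_def)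
  also have "\<dots> = (LINT r:{a..l}|lebesgue. ?h r)"
  proof (rule set_lebesgue_integral_cong)
    show "\<forall>r. r \<in> {a..l} \<longrightarrow>
        1 / Gamma \<beta> * (deriv_Icc a b \<Phi> r * (\<Phi> l - \<Phi> r) powr (\<beta> - 1) * z r) = ?h r"
    proof (intro allI impI)
      fix r assume "r \<in> {a..l}"
      then have "r \<in> {a..b}" using l by auto
      then show "1 / Gamma \<beta> * (deriv_Icc a b \<Phi> r * (\<Phi> l - \<Phi> r) powr (\<beta> - 1) * z r) = ?h r"
        using z[of r] pos[of r] by (simp add: f_def X_def RL_kernel_def)
    qed
  qed simp
  also have "\<dots> = integral {0..X} f"
    using h set_lebesgue_integral_eq_integral(2) by metis
  finally show ?thesis using False by (simp add: f_def[abs_def] X_def)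
qed

section \<open>Positivity for the two-term Caputo inequality\<close>

theorem lemma6:
  fixes a b \<kappa> \<mu> \<omega> :: real and \<Phi> \<gamma> :: "real \<Rightarrow> real"
  assumes "0 \<le> a" and "a < b"
    and "C1_Icc a b \<Phi>"
    and "mono_on {a..b} \<Phi>"
    and "\<forall>l\<in>{a..b}. deriv_Icc a b \<Phi> l \<noteq> 0"
    and "\<kappa> \<in> {0<..1}" and "\<mu> \<in> {0<..1}" and "\<kappa> < \<mu>"
    and "\<omega> > 0"
    and "continuous_on {a..b} \<gamma>"
    and "has_continuous_Caputo_deriv a b \<Phi> \<mu> \<gamma>"
    and "has_continuous_Caputo_deriv a b \<Phi> \<kappa> \<gamma>"
    and "\<forall>l\<in>{a<..b}. Caputo_deriv a b \<Phi> \<mu> \<gamma> l + \<omega> * Caputo_deriv a b \<Phi> \<kappa> \<gamma> l \<ge> 0"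
    and "\<gamma> a \<ge> 0"
  shows "\<forall>l\<in>{a..b}. \<gamma> l \<ge> 0"
proof -
  have pos: "0 < deriv_Icc a b \<Phi> x" if "x \<in> {a..b}" for x
    using mono_deriv_Icc_pos assms that by blast
  have cont_\<Phi>: "continuous_on {a..b} \<Phi>" by (rule C1_Icc_continuous_on) fact
  have smono: "strict_mono_on {a..b} \<Phi>"
  proof (rule strict_mono_onI)
    fix x y assume xy: "x \<in> {a..b}" "y \<in> {a..b}" "x < y"
    show "\<Phi> x < \<Phi> y"
    proof (rule DERIV_pos_imp_increasing_open[OF \<open>x < y\<close>])
      show "\<exists>D. DERIV \<Phi> w :> D \<and> 0 < D" if "x < w" "w < y" for w
        using C1_Icc_has_real_derivative[OF assms(3), of w] pos[of w] that xy
        by (auto simp: at_within_Icc_at)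
      show "continuous_on {x..y} \<Phi>"
        using cont_\<Phi> xy by (auto intro: continuous_on_subset)
    qed
  qed
  define \<tau> where "\<tau> r = \<Phi> r - \<Phi> a" for r
  define T where "T = \<tau> b"
  define \<psi> where "\<psi> = inv_into {a..b} \<tau>"
  have inj: "inj_on \<tau> {a..b}"
    using strict_mono_on_imp_inj_on[OF smono] by (auto simp: inj_on_def \<tau>_def)
  have cont_\<tau>: "continuous_on {a..b} \<tau>"
    unfolding \<tau>_def by (intro continuous_intros cont_\<Phi>)
  have \<tau>_mem: "\<tau> r \<in> {0..T}" if "r \<in> {a..b}" for r
    using strict_mono_on_leD[OF smono, of a r] strict_mono_on_leD[OF smono, of r b] that
    by (auto simp: \<tau>_def T_def)
  have img: "\<tau> ` {a..b} = {0..T}"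
  proof (rule antisym)
    show "{0..T} \<subseteq> \<tau> ` {a..b}"
      using IVT'[of \<tau> a _ b] cont_\<tau> \<open>a < b\<close> by (fastforce simp: T_def \<tau>_def)
  qed (use \<tau>_mem in auto)
  have \<psi>: "\<psi> x \<in> {a..b}" "\<tau> (\<psi> x) = x" if "x \<in> {0..T}" for x
    using that img by (auto simp: \<psi>_def f_inv_into_f inv_into_into simp del: atLeastAtMost_iff)
  have \<psi>_\<tau>: "\<psi> (\<tau> r) = r" if "r \<in> {a..b}" for r
    using inj that by (simp add: \<psi>_def)
  have cont_\<psi>: "continuous_on {0..T} \<psi>"
    using continuous_on_inv[OF cont_\<tau>, of \<psi>] \<psi>_\<tau> img by auto
  have T0: "0 \<le> T" using \<tau>_mem[of b] \<open>a < b\<close> by simp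
  \<comment> \<open>Clamping the argument makes \<open>u\<close> continuous on the whole line; it vanishes on the negative half-line
      because \<open>\<psi> 0 = a\<close>.\<close>
  define u where "u x = \<gamma> (\<psi> (max 0 (min x T))) - \<gamma> a" for x
  have u_\<tau>: "\<gamma> r - \<gamma> a = u (\<tau> r)" if "r \<in> {a..b}" for r
    using \<tau>_mem[OF that] \<psi>_\<tau>[OF that] by (simp add: u_def)
  have u0: "u x = 0" if "x \<le> 0" for x
    using that T0 \<psi>_\<tau>[of a] \<open>a < b\<close> by (simp add: u_def \<tau>_def)
  have cont_u: "continuous_on UNIV u"
    unfolding u_def using T0 \<psi>(1)
    by (intro continuous_intros continuous_on_compose2[OF assms(10)] continuous_on_compose2[OF cont_\<psi>]) auto
  \<comment> \<open>For \<open>\<mu> = 1\<close> the Riemann-Liouville integral of order \<open>1 - \<mu>\<close> is the identity; \<open>1 - \<kappa>\<close> is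
      positive, so \<open>k\<close> is a positive kernel also in this case.\<close>
  define c :: real where "c = (if \<mu> = 1 then 1 else 0)"
  define k where "k s = RL_kernel (1 - \<mu>) s + \<omega> * RL_kernel (1 - \<kappa>) s" for s
  define z where "z r = \<gamma> r - \<gamma> a" for r
  define R where "R l = RL_integral a b \<Phi> (1 - \<mu>) z l + \<omega> * RL_integral a b \<Phi> (1 - \<kappa>) z l" for l
  have R_eq: "R l = c * u (\<tau> l) + integral {0..\<tau> l} (\<lambda>s. k s * u (\<tau> l - s))"
    if l: "l \<in> {a..b}" for l
  proof -
    have int: "(\<lambda>s. RL_kernel \<beta> s * u (\<tau> l - s)) integrable_on {0..\<tau> l}" if "0 \<le> \<beta>" for \<beta>
      using that \<tau>_mem[OF l]
      by (intro set_lebesgue_integral_eq_integral(1) absolutely_integrable_mult_continuous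
          RL_kernel_absolutely_integrable continuous_on_compose2[OF cont_u] continuous_intros) auto
    have eq: "RL_integral a b \<Phi> \<beta> z l = (if \<beta> = 0 then 1 else 0) * u (\<tau> l) +
        integral {0..\<tau> l} (\<lambda>s. RL_kernel \<beta> s * u (\<tau> l - s))" if "0 \<le> \<beta>" for \<beta>
      using RL_integral_eq_convolution[OF that assms(3) smono pos cont_u _ l, of z] u_\<tau>
      by (simp add: \<tau>_def z_def)
    have "integral {0..\<tau> l} (\<lambda>s. k s * u (\<tau> l - s)) =
        integral {0..\<tau> l} (\<lambda>s. RL_kernel (1 - \<mu>) s * u (\<tau> l - s)) +
        \<omega> * integral {0..\<tau> l} (\<lambda>s. RL_kernel (1 - \<kappa>) s * u (\<tau> l - s))"
      using integral_add[OF int[of "1 - \<mu>"] integrable_on_mult_right[OF int[of "1 - \<kappa>"], of \<omega>]]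
        assms(6,7) by (simp add: k_def algebra_simps)
    then show ?thesis
      using eq[of "1 - \<mu>"] eq[of "1 - \<kappa>"] assms(6-8) by (simp add: R_def c_def)
  qed
  have C1_R: "C1_Icc a b (RL_integral a b \<Phi> (1 - \<mu>) z)" "C1_Icc a b (RL_integral a b \<Phi> (1 - \<kappa>) z)"
    using assms(11,12) by (simp_all add: has_continuous_Caputo_deriv_def z_def[abs_def])
  have "mono_on {a..b} R"
    unfolding R_def
  proof (rule nonneg_deriv_Icc_imp_mono_on[OF C1_Icc_add_mult(1)[OF C1_R \<open>a < b\<close>]])
    fix x assume x: "x \<in> {a<..<b}"
    have "0 \<le> deriv_Icc a b \<Phi> x * (Caputo_deriv a b \<Phi> \<mu> \<gamma> x + \<omega> * Caputo_deriv a b \<Phi> \<kappa> \<gamma> x)"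
      using pos[of x] assms(13) x by simp
    also have "\<dots> = deriv_Icc a b (RL_integral a b \<Phi> (1 - \<mu>) z) x
        + \<omega> * deriv_Icc a b (RL_integral a b \<Phi> (1 - \<kappa>) z) x"
      using pos[of x] x by (simp add: Caputo_deriv_def z_def[abs_def] field_simps)
    also have "\<dots> = deriv_Icc a b
        (\<lambda>l. RL_integral a b \<Phi> (1 - \<mu>) z l + \<omega> * RL_integral a b \<Phi> (1 - \<kappa>) z l) x"
      using C1_Icc_add_mult(2)[OF C1_R \<open>a < b\<close>] x by simp
    finally show "0 \<le> deriv_Icc a b
        (\<lambda>l. RL_integral a b \<Phi> (1 - \<mu>) z l + \<omega> * RL_integral a b \<Phi> (1 - \<kappa>) z l) x" .
  qed
  have mono_G: "mono_on {0..T} (\<lambda>x. c * u x + integral {0..x} (\<lambda>s. k s * u (x - s)))"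
  proof (rule mono_onI)
    fix x y assume xy: "x \<in> {0..T}" "y \<in> {0..T}" "x \<le> y"
    have "\<psi> x \<le> \<psi> y"
    proof (rule ccontr)
      assume "\<not> \<psi> x \<le> \<psi> y"
      then have "\<tau> (\<psi> y) < \<tau> (\<psi> x)"
        using strict_mono_onD[OF smono, of "\<psi> y" "\<psi> x"] \<psi>(1)[OF xy(1)] \<psi>(1)[OF xy(2)]
        by (simp add: \<tau>_def)
      then show False using \<psi>(2) xy by simp
    qed
    then have "R (\<psi> x) \<le> R (\<psi> y)"
      using mono_onD[OF \<open>mono_on {a..b} R\<close>] \<psi>(1) xy by blast
    then show "c * u x + integral {0..x} (\<lambda>s. k s * u (x - s)) \<le>
        c * u y + integral {0..y} (\<lambda>s. k s * u (y - s))"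
      using R_eq[OF \<psi>(1)] \<psi>(2) xy by simp
  qed
  have k_nonneg: "0 \<le> k s" for s
    using RL_kernel_nonneg assms(6,7,9) by (simp add: k_def)
  have k_pos: "0 < k s" if "0 < s" for s
    using RL_kernel_nonneg[of "1 - \<mu>" s] RL_kernel_pos[of "1 - \<kappa>" s] that assms(6-9)
    by (simp add: k_def add_nonneg_pos)
  have k_antimono: "antimono_on {0<..} k"
    using RL_kernel_antimono[of "1 - \<mu>"] RL_kernel_antimono[of "1 - \<kappa>"] assms(6,7,9)
    by (auto simp: monotone_on_def k_def intro!: add_mono mult_left_mono)
  have k_int: "k absolutely_integrable_on {0..x}" if "0 \<le> x" for x
    unfolding k_def using that assms(6,7)
    by (intro set_integral_add(1) set_integrable_mult_right RL_kernel_absolutely_integrable) auto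
  have "0 \<le> u x" if "x \<in> {0..T}" for x
    by (rule nonneg_of_mono_convolution[OF k_nonneg k_pos k_antimono k_int _ cont_u u0 mono_G that])
       (auto simp: c_def)
  then have "0 \<le> \<gamma> l - \<gamma> a" if "l \<in> {a..b}" for l
    using u_\<tau>[OF that] \<tau>_mem[OF that] by simp
  then show ?thesis using \<open>\<gamma> a \<ge> 0\<close> by force
qed

end
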